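(* Let $k\ge 1$ be an integer and let $p\in[0,1)$. There exists an $(l,\mathbb{N},2^k,0)$ VLSF code for the binary erasure channel BEC$(p)$ with $$l \;\le\; k+\frac{1}{C}\sum_{i=0}^{k-1}\frac{2^k-1}{2^k-2^i}\,F(i;k,1-p),$$ where $C=1-p$ and $$F(i;k,1-p)\triangleq\sum_{j=0}^{i}\binom{k}{j}(1-p)^{j}p^{k-j}$$ is the CDF, evaluated at $i$, of a binomial distribution with $k$ trials and success probability $1-p$ (with the convention $0^0=1$).
   Context: Notation: $\mathbb{N}=\{0,1,2,\dots\}$ and $[M]=\{1,\dots,M\}$. Channel: the BEC$(p)$ is the memoryless channel with input alphabet $\mathcal{X}=\{0,1\}$ and output alphabet $\mathcal{Y}=\{0,?,1\}$. At each time $n=1,2,\dots$, independently of everything else, the output $Y_n$ equals the erasure symbol $?$ with probability $p$, and equals the input $X_n$ with probability $1-p$. Write $Y^n=(Y_1,\dots,Y_n)$. An $(l,\mathbb{N},M,0)$ variable-length stop-feedback (VLSF) code, with real $l>0$ and positive integer $M$ (infinitely many decoding times, zero error), consists of: 1) A finite alphabet $\mathcal{U}$ and a probability distribution on $\mathcal{U}$ defining a random variable $U$ (common randomness), independent of the message and of the channel erasures, revealed to both transmitter and receiver before transmission. 2) A sequence of encoders $f_n:\mathcal{U}\times[M]\to\mathcal{X}$, $n=1,2,\dots$, defining the channel inputs $X_n=f_n(U,W)$, where $W$ is uniformly distributed on $[M]$. 3) A random stopping time $\tau$ with values in $\mathbb{N}$ (almost surely finite) of the filtration generated by $\{U,Y^n\}_{n\in\mathbb{N}}$,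 satisfying $\mathbb{E}[\tau]\le l$. 4) Decoding functions $g_n:\mathcal{U}\times\mathcal{Y}^n\to[M]$, $n\in\mathbb{N}$. The final decision $\hat W=g_\tau(U,Y^\tau)$ must satisfy $\mathbb{P}[\hat W\ne W]=0$. *)

theory Defs
  imports "HOL-Probability.Probability"
begin

text \<open>
  Channel inputs are \<open>bool\<close> (\<open>False\<close> for 0, \<open>True\<close> for 1); channel outputs are \<open>bool option\<close>
  (\<open>None\<close> for the erasure symbol).

  A sample point is a triple of the common randomness, the message and the erasure pattern.
  Times start at 1: coordinate 0 of the erasure pattern and the encoder at time 0 are never used.
\<close>

type_synonym 'u sample = "'u \<times> nat \<times> (nat \<Rightarrow> bool)"

definition sample_space :: "real \<Rightarrow> nat \<Rightarrow> 'u pmf \<Rightarrow> 'u sample measure" where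
  "sample_space p M PU =
     measure_pmf PU \<Otimes>\<^sub>M
     (measure_pmf (pmf_of_set {1..M}) \<Otimes>\<^sub>M
      (\<Pi>\<^sub>M n\<in>UNIV. measure_pmf (bernoulli_pmf p)))"

definition common_rand :: "'u sample \<Rightarrow> 'u" where
  "common_rand = (\<lambda>(u, w, e). u)"

definition message :: "'u sample \<Rightarrow> nat" where
  "message = (\<lambda>(u, w, e). w)"

definition channel_output :: "(nat \<Rightarrow> 'u \<Rightarrow> nat \<Rightarrow> bool) \<Rightarrow> nat \<Rightarrow> 'u sample \<Rightarrow> bool option" where
  "channel_output f n = (\<lambda>(u, w, e). if e n then None else Some (f n u w))"

definition outputs_upto :: "(nat \<Rightarrow> 'u \<Rightarrow> nat \<Rightarrow> bool) \<Rightarrow> nat \<Rightarrow> 'u sample \<Rightarrow> bool option list" where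
  "outputs_upto f n \<omega> = map (\<lambda>i. channel_output f i \<omega>) [1..<Suc n]"

text \<open>
  The stopping time may be infinite on a null set, so the time index is \<open>enat\<close>. The condition
  that \<open>stopping_time\<close> imposes at index \<open>\<infinity>\<close> is trivial. The common randomness takes values in
  a finite alphabet, so its generated \<open>\<sigma>\<close>-algebra contains the preimage of every set.
\<close>

definition output_filtration :: "(nat \<Rightarrow> 'u \<Rightarrow> nat \<Rightarrow> bool) \<Rightarrow> enat \<Rightarrow> 'u sample measure" where
  "output_filtration f t =
     sigma UNIV {(\<lambda>\<omega>. (common_rand \<omega>, outputs_upto f n \<omega>)) -` B | n B. enat n \<le> t}"

text \<open>
  The expectation of the stopping time is an integral over \<open>ennreal\<close>: unlike the Bochner
  integral, it is \<open>\<infinity>\<close>, not 0, when the stopping time is not integrable.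
\<close>

definition BEC_VLSF_zero_error_code ::
  "real \<Rightarrow> real \<Rightarrow> nat \<Rightarrow> 'u set \<Rightarrow> 'u pmf \<Rightarrow> (nat \<Rightarrow> 'u \<Rightarrow> nat \<Rightarrow> bool) \<Rightarrow>
   ('u sample \<Rightarrow> enat) \<Rightarrow> (nat \<Rightarrow> 'u \<Rightarrow> bool option list \<Rightarrow> nat) \<Rightarrow> bool"
where
  "BEC_VLSF_zero_error_code p l M \<U> PU f \<tau> g \<longleftrightarrow>
     0 < l \<and> 0 < M \<and>
     finite \<U> \<and> set_pmf PU \<subseteq> \<U> \<and>
     stopping_time (output_filtration f) \<tau> \<and>
     (AE \<omega> in sample_space p M PU. \<tau> \<omega> < \<infinity>) \<and>
     (\<integral>\<^sup>+ \<omega>. ennreal_of_enat (\<tau> \<omega>) \<partial>sample_space p M PU) \<le> ennreal l \<and>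
     (\<forall>n. \<forall>u\<in>\<U>. \<forall>ys. length ys = n \<longrightarrow> g n u ys \<in> {1..M}) \<and>
     (AE \<omega> in sample_space p M PU. \<forall>n. \<tau> \<omega> = enat n \<longrightarrow>
        g n (common_rand \<omega>) (outputs_upto f n \<omega>) = message \<omega>)"

definition binomial_cdf :: "nat \<Rightarrow> nat \<Rightarrow> real \<Rightarrow> real" where
  "binomial_cdf i k q = (\<Sum>j=0..i. real (k choose j) * q ^ j * (1 - q) ^ (k - j))"

lemma filtration_output_filtration: "filtration UNIV (output_filtration f)"
proof
  show "space (output_filtration f t) = UNIV" for t
    by (simp add: output_filtration_def)
  show "sets (output_filtration f s) \<subseteq> sets (output_filtration f t)" if "s \<le> t" for s t
    using that unfolding output_filtration_def
    by (subst (1 2) sets_measure_of) (auto intro!: sigma_sets_mono' intro: order_trans)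
qed

lemma prob_space_sample_space: "prob_space (sample_space p M PU)"
proof -
  interpret E: prob_space "\<Pi>\<^sub>M n\<in>(UNIV :: nat set). measure_pmf (bernoulli_pmf p)"
    by (intro prob_space_PiM prob_space_measure_pmf)
  interpret WE: pair_prob_space "measure_pmf (pmf_of_set {1..M})"
    "\<Pi>\<^sub>M n\<in>(UNIV :: nat set). measure_pmf (bernoulli_pmf p)" ..
  interpret UWE: pair_prob_space "measure_pmf PU"
    "measure_pmf (pmf_of_set {1..M}) \<Otimes>\<^sub>M (\<Pi>\<^sub>M n\<in>(UNIV :: nat set). measure_pmf (bernoulli_pmf p))" ..
  show ?thesis
    unfolding sample_space_def by (rule UWE.prob_space_axioms)
qed

end

theory Submission
  imports Defs
begin

text \<open>
  The code is linear and deterministic: messages are subsets of \<open>{..<k}\<close>, the input at time \<open>n\<close> is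
  the parity of the message on a column \<open>c n \<subseteq> {..<k}\<close>, and decoding stops as soon as the nullspace
  of the received columns is trivial. The first \<open>k\<close> columns are the unit vectors, so after \<open>k\<close> symbols
  the rank is binomial. A uniformly random nonzero column raises the rank \<open>i\<close> with probability
  \<open>(2 ^ k - 2 ^ i) / (2 ^ k - 1)\<close>, so the waiting time for rank \<open>i + 1\<close> contributes the \<open>i\<close>-th summand
  of the bound, weighted by the probability that the rank at time \<open>k\<close> is at most \<open>i\<close>. Since the common
  randomness is finite, infinitely many random columns are not available; instead each further column
  is chosen by the method of conditional expectations.
\<close>

subsection \<open>Binary orthogonality\<close>

text \<open>Sets stand for their indicator vectors over the field with two elements: symmetric
  difference is addition, the parity of an intersection is the standard bilinear form, and
  \<open>xor_closed\<close> describes linear subspaces.\<close>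

definition xor_closed :: "'a set set \<Rightarrow> bool" where
  "xor_closed K \<longleftrightarrow> {} \<in> K \<and> (\<forall>x\<in>K. \<forall>y\<in>K. sym_diff x y \<in> K)"

lemma card_sym_diff:
  assumes "finite A" "finite B"
  shows "card (sym_diff A B) + 2 * card (A \<inter> B) = card A + card B"
proof -
  have "card (sym_diff A B) = card (A - B) + card (B - A)"
    using assms by (intro card_Un_disjoint) auto
  moreover have "card A = card (A - B) + card (A \<inter> B)"
    using assms card_Diff_subset_Int[of A B] card_mono[of A "A \<inter> B"] by simp
  moreover have "card B = card (B - A) + card (A \<inter> B)"
    using assms card_Diff_subset_Int[of B A] card_mono[of B "A \<inter> B"] by (simp add: Int_commute)
  ultimately show ?thesis by simp
qed

text \<open>Additivity of the bilinear form in its second argument.\<close>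

lemma even_card_Int_sym_diff:
  assumes "finite x" "finite y"
  shows "even (card (c \<inter> sym_diff x y)) \<longleftrightarrow> (even (card (c \<inter> x)) \<longleftrightarrow> even (card (c \<inter> y)))"
proof -
  have "c \<inter> sym_diff x y = sym_diff (c \<inter> x) (c \<inter> y)" by blast
  then have "card (c \<inter> sym_diff x y) + 2 * card ((c \<inter> x) \<inter> (c \<inter> y)) = card (c \<inter> x) + card (c \<inter> y)"
    using card_sym_diff[of "c \<inter> x" "c \<inter> y"] assms by simp
  then show ?thesis by presburger
qed

text \<open>Translation by \<open>a\<close> is an involution of \<open>K\<close> that exchanges the
  even and the odd members.\<close>

lemma card_even_half:
  assumes "xor_closed K" "finite K" "\<And>x. x \<in> K \<Longrightarrow> finite x"
    and a: "a \<in> K" "odd (card (c \<inter> a))"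
  shows "2 * card {m\<in>K. even (card (c \<inter> m))} = card K"
    and "2 * card {m\<in>K. odd (card (c \<inter> m))} = card K"
proof -
  have "bij_betw (sym_diff a) {m\<in>K. even (card (c \<inter> m))} {m\<in>K. odd (card (c \<inter> m))}"
  proof (rule bij_betw_byWitness[where f' = "sym_diff a"])
    show "sym_diff a ` {m \<in> K. even (card (c \<inter> m))} \<subseteq> {m \<in> K. odd (card (c \<inter> m))}"
      using assms by (auto simp: xor_closed_def even_card_Int_sym_diff)
    show "sym_diff a ` {m \<in> K. odd (card (c \<inter> m))} \<subseteq> {m \<in> K. even (card (c \<inter> m))}"
      using assms by (auto simp: xor_closed_def even_card_Int_sym_diff)
  qed blast+
  then have eq: "card {m\<in>K. even (card (c \<inter> m))} = card {m\<in>K. odd (card (c \<inter> m))}"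
    by (rule bij_betw_same_card)
  have "card K = card ({m\<in>K. even (card (c \<inter> m))} \<union> {m\<in>K. odd (card (c \<inter> m))})"
    by (rule arg_cong[where f = card]) blast
  also have "\<dots> = card {m\<in>K. even (card (c \<inter> m))} + card {m\<in>K. odd (card (c \<inter> m))}"
    using assms(2) by (intro card_Un_disjoint) auto
  finally show "2 * card {m\<in>K. even (card (c \<inter> m))} = card K"
    and "2 * card {m\<in>K. odd (card (c \<inter> m))} = card K"
    using eq by simp_all
qed

text \<open>Count the pairs \<open>(c, m)\<close> with \<open>m \<in> K\<close> and \<open>c \<inter> m\<close> odd in two ways: every
  \<open>m \<noteq> {}\<close> and every \<open>c\<close> outside the annihilator of \<open>K\<close> lies in half of all possible pairs.\<close>

lemma card_annihilator:
  fixes K :: "'a set set"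
  assumes K: "xor_closed K" "K \<subseteq> Pow S" and S: "finite S"
  shows "card {c\<in>Pow S. \<forall>m\<in>K. even (card (c \<inter> m))} * card K = 2 ^ card S"
proof -
  let ?A = "{c\<in>Pow S. \<forall>m\<in>K. even (card (c \<inter> m))}"
  have finP: "finite (Pow S)" using S by simp
  have finK: "finite K" using finite_subset[OF K(2) finP] .
  have finm: "finite x" if "x \<in> K" for x using that K(2) S by (intro finite_subset[of x S]) auto
  have xorP: "xor_closed (Pow S)" by (auto simp: xor_closed_def)
  have "(\<Sum>c\<in>Pow S. 2 * card {m\<in>K. odd (card (c \<inter> m))})
      = (\<Sum>m\<in>K. 2 * card {c\<in>Pow S. odd (card (m \<inter> c))})"
    unfolding sum_distrib_left[symmetric]
    by (rule arg_cong[where f = "(*) 2"],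
        rule sum_multicount_gen[OF finP finK, of "\<lambda>c m. odd (card (c \<inter> m))"])
      (simp add: Int_commute)
  moreover have "(\<Sum>c\<in>Pow S. 2 * card {m\<in>K. odd (card (c \<inter> m))}) = (\<Sum>c\<in>Pow S - ?A. card K)"
  proof (rule sum.mono_neutral_cong_right[OF finP])
    show "\<forall>c\<in>Pow S - (Pow S - ?A). 2 * card {m\<in>K. odd (card (c \<inter> m))} = 0"
      by (auto simp: card_eq_0_iff)
    show "2 * card {m\<in>K. odd (card (c \<inter> m))} = card K" if c: "c \<in> Pow S - ?A" for c
    proof -
      from c obtain a where "a \<in> K" "odd (card (c \<inter> a))" by auto
      then show ?thesis using card_even_half(2)[OF K(1) finK finm] by blast
    qed
  qed blast
  moreover have "(\<Sum>m\<in>K. 2 * card {c\<in>Pow S. odd (card (m \<inter> c))}) = (\<Sum>m\<in>K - {{}}. 2 ^ card S)"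
  proof (rule sum.mono_neutral_cong_right[OF finK])
    show "2 * card {c\<in>Pow S. odd (card (m \<inter> c))} = 2 ^ card S" if m: "m \<in> K - {{}}" for m
    proof -
      from m obtain x where x: "x \<in> m" by blast
      then have "{x} \<in> Pow S" "odd (card (m \<inter> {x}))" using m K(2) by auto
      then have "2 * card {c\<in>Pow S. odd (card (m \<inter> c))} = card (Pow S)"
        using xorP finP S by (intro card_even_half(2)) (auto intro: finite_subset)
      then show ?thesis by (simp add: card_Pow S)
    qed
  qed auto
  ultimately have "card (Pow S - ?A) * card K = card (K - {{}}) * 2 ^ card S" by simp
  moreover have "card (Pow S - ?A) = 2 ^ card S - card ?A"
    using S by (subst card_Diff_subset) (auto simp: card_Pow)
  moreover have "card (K - {{}}) = card K - 1" using K(1) by (simp add: xor_closed_def)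
  ultimately have *: "(2 ^ card S - card ?A) * card K = (card K - 1) * 2 ^ card S" by simp
  \<comment> \<open>The subtractions in \<open>*\<close> are truncated, so they are replaced by sums
    before the algebra: with \<open>q\<close> and \<open>j\<close>, cancellation leaves
    \<open>q = card ?A * j\<close>.\<close>
  have "card ?A \<le> 2 ^ card S" using card_mono[OF finP, of ?A] by (auto simp: card_Pow S)
  then obtain q where q: "2 ^ card S = card ?A + q" using le_Suc_ex by blast
  have "card K \<noteq> 0" using K(1) finK by (auto simp: xor_closed_def)
  then obtain j where j: "card K = Suc j" using not0_implies_Suc by blast
  show ?thesis using * unfolding q j by (simp add: algebra_simps)
qed

text \<open>By \<open>card_annihilator\<close> the cardinality divides a power of two, which yields
  the dimension \<open>d\<close> without any use of bases.\<close>

lemma card_xor_closed: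
  assumes "xor_closed K" "K \<subseteq> Pow S" "finite S"
  obtains d where "d \<le> card S" "card K = 2 ^ d"
proof -
  have "card K dvd 2 ^ card S"
    unfolding card_annihilator[OF assms, symmetric] by (rule dvd_triv_right)
  then obtain d where "d \<le> card S" "card K = 2 ^ d"
    unfolding divides_primepow_nat[OF two_is_prime_nat] by blast
  then show ?thesis by (rule that)
qed


subsection \<open>Greedy choice of the columns\<close>

text \<open>Two messages agree in all symbols sent at the times in \<open>R\<close> exactly when
  their symmetric difference lies here. Decoding is therefore unambiguous once only
  \<open>{}\<close> is left.\<close>

definition nullspace :: "nat \<Rightarrow> (nat \<Rightarrow> nat set) \<Rightarrow> nat set \<Rightarrow> nat set set" where
  "nullspace k c R = {m. m \<subseteq> {..<k} \<and> (\<forall>i\<in>R. even (card (c i \<inter> m)))}"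

text \<open>
  A nullspace of dimension \<open>d\<close> means rank \<open>k - d\<close>, so the condition on \<open>i\<close> below is \<open>rank \<le> i\<close>: the cost
  is the expected number of further unerased random columns until full rank.
\<close>

definition cost :: "nat \<Rightarrow> nat set set \<Rightarrow> real" where
  "cost k K = (\<Sum>i | i < k \<and> 2 ^ k \<le> 2 ^ i * card K. (2 ^ k - 1) / (2 ^ k - 2 ^ i))"

text \<open>The set \<open>R\<close> consists of the times up to \<open>n\<close> whose symbols are not erased.\<close>

definition erasure_mean :: "real \<Rightarrow> nat \<Rightarrow> (nat set \<Rightarrow> real) \<Rightarrow> real" where
  "erasure_mean p n h = (\<Sum>R\<in>Pow {1..n}. (1 - p) ^ card R * p ^ (n - card R) * h R)"

lemma cost_nonneg: "0 \<le> cost k K"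
  unfolding cost_def by (intro sum_nonneg divide_nonneg_nonneg) auto

lemma cost_eq:
  assumes "card K = 2 ^ d" "d \<le> k"
  shows "cost k K = (\<Sum>i\<in>{k - d..<k}. (2 ^ k - 1) / (2 ^ k - 2 ^ i))"
proof -
  have iff: "(2::nat) ^ k \<le> 2 ^ i * 2 ^ d \<longleftrightarrow> k \<le> i + d" for i
    unfolding power_add[symmetric] by (rule power_increasing_iff) simp
  have "{i. i < k \<and> 2 ^ k \<le> 2 ^ i * card K} = {k - d..<k}"
    unfolding assms(1) iff by auto
  then show ?thesis by (simp only: cost_def)
qed

text \<open>With \<open>d\<close> the dimension of \<open>K\<close>, a column in the annihilator
  leaves \<open>K\<close> unchanged, and any other column halves it and so removes one summand of
  the cost. The weights of \<open>cost\<close> are chosen so that the total decrease over all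
  columns is the same for every nontrivial \<open>K\<close>.\<close>

lemma cost_drift:
  assumes K: "xor_closed K" "K \<subseteq> Pow {..<k}"
  shows "(\<Sum>c\<in>Pow {..<k} - {{}}. cost k {m\<in>K. even (card (c \<inter> m))})
    = (2 ^ k - 1) * (cost k K - of_bool (K \<noteq> {{}}))"
proof -
  let ?A = "{c\<in>Pow {..<k}. \<forall>m\<in>K. even (card (c \<inter> m))}"
  have finK: "finite K" using K(2) by (rule finite_subset) simp
  have finm: "finite m" if "m \<in> K" for m
    using that K(2) by (intro finite_subset[of m "{..<k}"]) auto
  obtain d where d: "d \<le> k" "card K = 2 ^ d"
    using card_xor_closed[OF K] by auto
  have "card ?A * 2 ^ d = 2 ^ (k - d) * 2 ^ d"
    using card_annihilator[OF K] d by (simp only: power_add[symmetric] finite_lessThan card_lessThan le_add_diff_inverse2)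
  then have cardA: "card ?A = 2 ^ (k - d)" by (simp only: mult_cancel2 power_not_zero) simp
  have diff: "real (card (Pow {..<k} - ?A)) = 2 ^ k - 2 ^ (k - d)"
  proof -
    have "card (Pow {..<k} - ?A) = card (Pow {..<k}) - card ?A" by (rule card_Diff_subset) auto
    then have "card (Pow {..<k} - ?A) = 2 ^ k - 2 ^ (k - d)"
      by (simp only: cardA card_Pow finite_lessThan card_lessThan)
    moreover have "(2::nat) ^ (k - d) \<le> 2 ^ k" by (rule power_increasing) auto
    ultimately show ?thesis by (simp only: of_nat_diff of_nat_power of_nat_numeral)
  qed
  \<comment> \<open>The summand lost when the dimension falls from \<open>d\<close> to
    \<open>d - 1\<close>. Its denominator is the number of columns outside \<open>?A\<close>, so
    that many copies add up to \<open>2 ^ k - 1\<close>. For \<open>d = 0\<close> the denominator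
    vanishes and division by zero gives 0.\<close>
  let ?a = "(2 ^ k - 1) / (2 ^ k - 2 ^ (k - d)) :: real"
  have step: "cost k {m\<in>K. even (card (c \<inter> m))} = cost k K - (if c \<in> ?A then 0 else ?a)"
    if c: "c \<in> Pow {..<k}" for c
  proof (cases "c \<in> ?A")
    case True
    then have "{m\<in>K. even (card (c \<inter> m))} = K" by auto
    with True show ?thesis by simp
  next
    case False
    with c obtain a where "a \<in> K" "odd (card (c \<inter> a))" by auto
    then have half: "2 * card {m\<in>K. even (card (c \<inter> m))} = 2 ^ d"
      unfolding d(2)[symmetric] by (intro card_even_half(1)[OF K(1) finK finm])
    then have "d \<noteq> 0" by (intro notI) simp
    then obtain e where e: "d = Suc e" using not0_implies_Suc by blast
    then have "card {m\<in>K. even (card (c \<inter> m))} = 2 ^ e" using half by simp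
    then have 1: "cost k {m\<in>K. even (card (c \<inter> m))}
        = (\<Sum>i\<in>{k - e..<k}. (2 ^ k - 1) / (2 ^ k - 2 ^ i))"
      by (rule cost_eq) (use e d(1) in simp)
    have ins: "{k - d..<k} = insert (k - d) {k - e..<k}" "k - d \<notin> {k - e..<k}" using e d(1) by auto
    have 2: "cost k K = ?a + (\<Sum>i\<in>{k - e..<k}. (2 ^ k - 1) / (2 ^ k - 2 ^ i))"
      unfolding cost_eq[OF d(2,1)] ins(1) by (rule sum.insert[OF finite_atLeastLessThan ins(2)])
    show ?thesis unfolding 1 2 if_not_P[OF False] by (simp only: add_diff_cancel_left')
  qed
  have "(\<Sum>c\<in>Pow {..<k} - {{}}. cost k {m\<in>K. even (card (c \<inter> m))})
      = (\<Sum>c\<in>Pow {..<k} - {{}}. cost k K - (if c \<in> ?A then 0 else ?a))"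
    by (intro sum.cong refl step) auto
  also have "\<dots> = real (card (Pow {..<k} - {{}})) * cost k K
      - (\<Sum>c\<in>Pow {..<k} - {{}}. if c \<in> ?A then 0 else ?a)"
    unfolding sum_subtractf by simp
  \<comment> \<open>The empty column lies in \<open>?A\<close>, so its exclusion does not change the
    sum.\<close>
  also have "(\<Sum>c\<in>Pow {..<k} - {{}}. if c \<in> ?A then 0 else ?a) = (\<Sum>c\<in>Pow {..<k} - ?A. ?a)"
    by (rule sum.mono_neutral_cong_right) auto
  also have "\<dots> = (2 ^ k - 1) * of_bool (K \<noteq> {{}})"
  proof (cases "d = 0")
    case True
    then obtain x where "K = {x}" using d by (auto simp: card_1_singleton_iff)
    then have "K = {{}}" using K(1) by (auto simp: xor_closed_def)
    then show ?thesis using diff True by simp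
  next
    case False
    then have "(2::nat) ^ d \<noteq> 1" by simp
    then have "K \<noteq> {{}}" using d(2) by (metis card_1_singleton_iff One_nat_def)
    moreover have "(2::real) ^ (k - d) < 2 ^ k" using False d(1) by (intro power_strict_increasing) auto
    ultimately show ?thesis using diff by simp
  qed
  also have "real (card (Pow {..<k} - {{}})) = 2 ^ k - 1"
    by (simp add: card_Diff_singleton card_Pow of_nat_diff)
  finally show ?thesis unfolding right_diff_distrib .
qed

section \<open>Nullspaces of received columns and averages over erasure patterns\<close>

lemma nullspace_subset: "nullspace k c R \<subseteq> Pow {..<k}"
  by (auto simp: nullspace_def)

lemma xor_closed_nullspace: "xor_closed (nullspace k c R)"
  unfolding xor_closed_def
proof (intro conjI ballI)
  fix x y assume xy: "x \<in> nullspace k c R" "y \<in> nullspace k c R"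
  have "finite z" if "z \<in> nullspace k c R" for z
    using that by (intro finite_subset[of z "{..<k}"]) (auto simp: nullspace_def)
  note fin = this[OF xy(1)] this[OF xy(2)]
  have "even (card (c i \<inter> sym_diff x y))" if "i \<in> R" for i
    unfolding even_card_Int_sym_diff[OF fin] using xy that by (simp add: nullspace_def)
  moreover have "sym_diff x y \<subseteq> {..<k}" using xy by (auto simp: nullspace_def)
  ultimately show "sym_diff x y \<in> nullspace k c R" by (simp only: nullspace_def) blast
qed (simp add: nullspace_def)

lemma nullspace_cong: "(\<And>i. i \<in> R \<Longrightarrow> c i = c' i) \<Longrightarrow> nullspace k c R = nullspace k c' R"
  by (simp add: nullspace_def)

lemma nullspace_insert:
  "nullspace k c (insert i R) = {m \<in> nullspace k c R. even (card (c i \<inter> m))}"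
  by (auto simp: nullspace_def)

text \<open>Conditioning on whether the symbol at time \<open>Suc n\<close> is erased.\<close>

lemma erasure_mean_Suc:
  "erasure_mean p (Suc n) h = erasure_mean p n (\<lambda>R. p * h R + (1 - p) * h (insert (Suc n) R))"
proof -
  let ?w = "\<lambda>n R. (1 - p) ^ card R * p ^ (n - card R)"
  have "erasure_mean p (Suc n) h = (\<Sum>R\<in>Pow {1..n} \<union> insert (Suc n) ` Pow {1..n}. ?w (Suc n) R * h R)"
    unfolding erasure_mean_def by (simp add: atLeastAtMostSuc_conv Pow_insert)
  also have "\<dots> = (\<Sum>R\<in>Pow {1..n}. ?w (Suc n) R * h R)
      + (\<Sum>R\<in>insert (Suc n) ` Pow {1..n}. ?w (Suc n) R * h R)"
    by (rule sum.union_disjoint) auto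
  also have "(\<Sum>R\<in>insert (Suc n) ` Pow {1..n}. ?w (Suc n) R * h R)
      = (\<Sum>R\<in>Pow {1..n}. ?w (Suc n) (insert (Suc n) R) * h (insert (Suc n) R))"
  proof (subst sum.reindex)
    show "inj_on (insert (Suc n)) (Pow {1..n})"
    proof (rule inj_onI)
      fix x y assume "x \<in> Pow {1..n}" "y \<in> Pow {1..n}" "insert (Suc n) x = insert (Suc n) y"
      moreover from this have "Suc n \<notin> x" "Suc n \<notin> y" by auto
      ultimately show "x = y" by (simp add: insert_ident)
    qed
  qed simp
  also have "(\<Sum>R\<in>Pow {1..n}. ?w (Suc n) R * h R) + \<dots>
      = (\<Sum>R\<in>Pow {1..n}. ?w n R * (p * h R + (1 - p) * h (insert (Suc n) R)))"
    unfolding sum.distrib[symmetric]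
  proof (rule sum.cong)
    fix R assume R: "R \<in> Pow {1..n}"
    then have fin: "finite R" by (intro finite_subset[of R "{1..n}"]) auto
    have "card R \<le> n" using R card_mono[of "{1..n}" R] by simp
    moreover have "Suc n \<notin> R" using R by auto
    ultimately show "?w (Suc n) R * h R + ?w (Suc n) (insert (Suc n) R) * h (insert (Suc n) R)
        = ?w n R * (p * h R + (1 - p) * h (insert (Suc n) R))"
      using fin by (simp add: Suc_diff_le algebra_simps)
  qed simp
  finally show ?thesis by (simp add: erasure_mean_def)
qed

lemma erasure_mean_cong:
  "(\<And>R. R \<subseteq> {1..n} \<Longrightarrow> h R = h' R) \<Longrightarrow> erasure_mean p n h = erasure_mean p n h'"
  by (simp add: erasure_mean_def)

lemma erasure_mean_nonneg:
  assumes "0 \<le> p" "p < 1" "\<And>R. 0 \<le> h R"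
  shows "0 \<le> erasure_mean p n h"
  unfolding erasure_mean_def using assms by (intro sum_nonneg) simp

lemma erasure_mean_add:
  "erasure_mean p n (\<lambda>R. h R + h' R) = erasure_mean p n h + erasure_mean p n h'"
  by (simp add: erasure_mean_def algebra_simps sum.distrib)

lemma erasure_mean_cmult: "erasure_mean p n (\<lambda>R. a * h R) = a * erasure_mean p n h"
  by (simp add: erasure_mean_def sum_distrib_left mult_ac)

lemma erasure_mean_sum:
  "erasure_mean p n (\<lambda>R. \<Sum>x\<in>X. h x R) = (\<Sum>x\<in>X. erasure_mean p n (h x))"
  unfolding erasure_mean_def sum_distrib_left by (rule sum.swap)

text \<open>For a uniformly random nonzero column the averaged relation is an equality, so some column
  satisfies the inequality.\<close>

lemma exists_good_column:
  fixes p :: real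
  assumes k: "k \<ge> 1"
  shows "\<exists>x. erasure_mean p (Suc n) (\<lambda>R. cost k (nullspace k (c(Suc n := x)) R))
      + (1 - p) * erasure_mean p n (\<lambda>R. of_bool (nullspace k c R \<noteq> {{}}))
      \<le> erasure_mean p n (\<lambda>R. cost k (nullspace k c R))"
proof (rule ccontr)
  let ?X = "Pow {..<k} - {{}}"
  let ?N = "nullspace k c"
  let ?next = "\<lambda>x. erasure_mean p (Suc n) (\<lambda>R. cost k (nullspace k (c(Suc n := x)) R))"
  let ?u = "erasure_mean p n (\<lambda>R. of_bool (?N R \<noteq> {{}}))"
  let ?E = "erasure_mean p n (\<lambda>R. cost k (?N R))"
  assume "\<not> ?thesis"
  then have less: "?E - (1 - p) * ?u < ?next x" for x
    unfolding not_ex not_le diff_less_eq by blast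
  have card: "real (card ?X) = 2 ^ k - 1"
    by (simp add: card_Diff_singleton card_Pow of_nat_diff)
  \<comment> \<open>An erasure at time \<open>Suc n\<close> keeps the nullspace; otherwise the new
    column \<open>x\<close> cuts it down. The earlier received columns do not see the update at
    \<open>Suc n\<close>.\<close>
  have "?next x = erasure_mean p n
      (\<lambda>R. p * cost k (?N R) + (1 - p) * cost k {m\<in>?N R. even (card (x \<inter> m))})" for x
  proof (unfold erasure_mean_Suc, rule erasure_mean_cong)
    fix R assume "R \<subseteq> {1..n}"
    then have "nullspace k (c(Suc n := x)) R = ?N R" by (intro nullspace_cong) auto
    then show "p * cost k (nullspace k (c(Suc n := x)) R)
          + (1 - p) * cost k (nullspace k (c(Suc n := x)) (insert (Suc n) R))
        = p * cost k (?N R) + (1 - p) * cost k {m\<in>?N R. even (card (x \<inter> m))}"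
      by (simp add: nullspace_insert)
  qed
  then have "(\<Sum>x\<in>?X. ?next x) = erasure_mean p n
      (\<lambda>R. \<Sum>x\<in>?X. p * cost k (?N R) + (1 - p) * cost k {m\<in>?N R. even (card (x \<inter> m))})"
    by (simp add: erasure_mean_sum)
  also have "\<dots> = erasure_mean p n (\<lambda>R. (2 ^ k - 1) * cost k (?N R)
      + (- (2 ^ k - 1) * (1 - p)) * of_bool (?N R \<noteq> {{}}))"
  proof (rule erasure_mean_cong)
    fix R
    show "(\<Sum>x\<in>?X. p * cost k (?N R) + (1 - p) * cost k {m\<in>?N R. even (card (x \<inter> m))})
      = (2 ^ k - 1) * cost k (?N R) + (- (2 ^ k - 1) * (1 - p)) * of_bool (?N R \<noteq> {{}})"
      unfolding sum.distrib sum_distrib_left[symmetric] sum_constant card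
        cost_drift[OF xor_closed_nullspace nullspace_subset]
      by (simp add: algebra_simps)
  qed
  also have "\<dots> = real (card ?X) * (?E - (1 - p) * ?u)"
    unfolding erasure_mean_add erasure_mean_cmult card by (simp add: algebra_simps)
  also have "\<dots> = (\<Sum>x\<in>?X. ?E - (1 - p) * ?u)" by simp
  also have "\<dots> < (\<Sum>x\<in>?X. ?next x)"
  proof (rule sum_strict_mono)
    \<comment> \<open>The strict inequality between the sums needs a nonempty index set, hence
      \<open>k \<ge> 1\<close>.\<close>
    have "{0} \<in> ?X" using k by auto
    then show "?X \<noteq> {}" by blast
  qed (use less in auto)
  finally show False by simp
qed

text \<open>The inequality at \<open>n\<close> involves only the columns up to \<open>Suc n\<close>,
  so the columns can be fixed one after another by dependent choice along the order of the natural
  numbers.\<close>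

lemma exists_columns:
  fixes p :: real
  assumes k: "k \<ge> 1"
  obtains c where "\<And>i. i \<in> {1..k} \<Longrightarrow> c i = {i - 1}"
    and "\<And>n. n \<ge> k \<Longrightarrow> erasure_mean p (Suc n) (\<lambda>R. cost k (nullspace k c R))
      + (1 - p) * erasure_mean p n (\<lambda>R. of_bool (nullspace k c R \<noteq> {{}}))
      \<le> erasure_mean p n (\<lambda>R. cost k (nullspace k c R))"
proof -
  let ?good = "\<lambda>n c. erasure_mean p (Suc n) (\<lambda>R. cost k (nullspace k c R))
      + (1 - p) * erasure_mean p n (\<lambda>R. of_bool (nullspace k c R \<noteq> {{}}))
      \<le> erasure_mean p n (\<lambda>R. cost k (nullspace k c R))"
  have cong: "?good n c = ?good n c'" if "\<And>i. i \<le> Suc n \<Longrightarrow> c i = c' i" for n c c'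
  proof -
    have eq: "nullspace k c R = nullspace k c' R" if "R \<subseteq> {1..Suc n}" for R
      using that \<open>\<And>i. i \<le> Suc n \<Longrightarrow> c i = c' i\<close> by (intro nullspace_cong) auto
    have 1: "erasure_mean p (Suc n) (\<lambda>R. h (nullspace k c R))
        = erasure_mean p (Suc n) (\<lambda>R. h (nullspace k c' R))" for h
      by (intro erasure_mean_cong arg_cong[where f = h] eq)
    have 2: "erasure_mean p n (\<lambda>R. h (nullspace k c R))
        = erasure_mean p n (\<lambda>R. h (nullspace k c' R))" for h
      by (intro erasure_mean_cong arg_cong[where f = h] eq) auto
    show ?thesis unfolding 1[of "cost k"] 2[of "cost k"] 2[of "\<lambda>K. of_bool (K \<noteq> {{}})"] ..
  qed
  \<comment> \<open>Column \<open>i\<close> is responsible for the inequality at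
    \<open>i - 1\<close>. Writing the candidate as the update \<open>c(i := x)\<close> makes the
    condition depend on \<open>c\<close> only below \<open>i\<close>, as dependent choice
    requires.\<close>
  define P where "P c i x \<longleftrightarrow>
    (if i \<le> k then x = {i - 1} else ?good (i - 1) (c(i := x)))" for c :: "nat \<Rightarrow> nat set" and i x
  have "\<exists>c. \<forall>i. P c i (c i)"
  proof (rule dependent_wf_choice[OF wf_less_than])
    fix c c' :: "nat \<Rightarrow> nat set" and i x
    assume "\<And>j. (j, i) \<in> less_than \<Longrightarrow> c j = c' j"
    then have eq: "c j = c' j" if "j < i" for j using that by simp
    show "P c i x = P c' i x"
    proof (cases "i \<le> k")
      case False
      have "?good (i - 1) (c(i := x)) = ?good (i - 1) (c'(i := x))"
        by (rule cong) (use False eq in auto)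
      with False show ?thesis by (simp add: P_def)
    qed (simp add: P_def)
  next
    fix i and c :: "nat \<Rightarrow> nat set"
    show "\<exists>x. P c i x"
    proof (cases "i \<le> k")
      case False
      then obtain n where n: "i = Suc n" by (cases i) auto
      obtain x where x: "erasure_mean p (Suc n) (\<lambda>R. cost k (nullspace k (c(Suc n := x)) R))
          + (1 - p) * erasure_mean p n (\<lambda>R. of_bool (nullspace k c R \<noteq> {{}}))
          \<le> erasure_mean p n (\<lambda>R. cost k (nullspace k c R))"
        using exists_good_column[OF k] by blast
      have eq: "erasure_mean p n (\<lambda>R. h (nullspace k (c(Suc n := x)) R))
          = erasure_mean p n (\<lambda>R. h (nullspace k c R))" for h
        by (intro erasure_mean_cong arg_cong[where f = h] nullspace_cong) auto
      have "?good n (c(Suc n := x))"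
        unfolding eq[of "cost k"] eq[of "\<lambda>K. of_bool (K \<noteq> {{}})"] by (rule x)
      then show ?thesis using False n by (auto simp: P_def)
    qed (simp add: P_def)
  qed
  then obtain c where c: "\<And>i. P c i (c i)" by blast
  show ?thesis
  proof (rule that)
    show "c i = {i - 1}" if "i \<in> {1..k}" for i using c[of i] that by (simp add: P_def)
    show "?good n c" if "n \<ge> k" for n using c[of "Suc n"] that by (simp add: P_def)
  qed
qed

text \<open>The mean cost is a potential: each step lowers it by at least \<open>1 - p\<close> times
  the probability of being undecoded, and it stays nonnegative, so the sum telescopes.\<close>

lemma sum_undecoded_le:
  fixes p :: real
  assumes p: "0 \<le> p" "p < 1"
    and step: "\<And>n. n \<ge> k \<Longrightarrow> erasure_mean p (Suc n) (\<lambda>R. cost k (nullspace k c R))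
      + (1 - p) * erasure_mean p n (\<lambda>R. of_bool (nullspace k c R \<noteq> {{}}))
      \<le> erasure_mean p n (\<lambda>R. cost k (nullspace k c R))"
  shows "(\<Sum>n\<in>{k..<N}. erasure_mean p n (\<lambda>R. of_bool (nullspace k c R \<noteq> {{}})))
    \<le> 1 / (1 - p) * erasure_mean p k (\<lambda>R. cost k (nullspace k c R))"
proof -
  let ?E = "\<lambda>n. erasure_mean p n (\<lambda>R. cost k (nullspace k c R))"
  let ?u = "\<lambda>n. erasure_mean p n (\<lambda>R. of_bool (nullspace k c R \<noteq> {{}}))"
  have nonneg: "0 \<le> ?E n" for n using p cost_nonneg by (intro erasure_mean_nonneg) auto
  have tele: "(1 - p) * (\<Sum>n\<in>{k..<k + j}. ?u n) + ?E (k + j) \<le> ?E k" for j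
  proof (induction j)
    case (Suc j)
    then show ?case using step[of "k + j"] by (simp add: algebra_simps)
  qed simp
  have "(1 - p) * (\<Sum>n\<in>{k..<N}. ?u n) \<le> ?E k"
  proof (cases "k \<le> N")
    case True
    then show ?thesis using tele[of "N - k"] nonneg[of N] by simp
  qed (use nonneg in simp)
  then show ?thesis using p by (simp add: field_simps)
qed

text \<open>For unit vectors the nullspace is the power set of the erased coordinates. The rank is
  thus the number of received symbols, which is binomially distributed, and exchanging the sums
  turns the weights into values of the CDF.\<close>

lemma erasure_mean_cost_systematic:
  fixes p :: real
  assumes k: "k \<ge> 1" and c: "\<And>i. i \<in> {1..k} \<Longrightarrow> c i = {i - 1}"
  shows "erasure_mean p k (\<lambda>R. cost k (nullspace k c R))
    = (\<Sum>i=0..k-1. (2 ^ k - 1) / (2 ^ k - 2 ^ i) * binomial_cdf i k (1 - p))"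
proof -
  let ?a = "\<lambda>i. (2 ^ k - 1) / (2 ^ k - 2 ^ i) :: real"
  let ?w = "\<lambda>j. (1 - p) ^ j * p ^ (k - j)"
  have cost: "cost k (nullspace k c R) = (\<Sum>i=0..k-1. of_bool (card R \<le> i) * ?a i)"
    if R: "R \<subseteq> {1..k}" for R
  proof -
    have "nullspace k c R = Pow ({..<k} - (\<lambda>i. i - 1) ` R)"
    proof -
      have "even (card (c i \<inter> m)) \<longleftrightarrow> i - 1 \<notin> m" if "i \<in> R" for i m
        using c[of i] that R by (cases "i - 1 \<in> m") auto
      then show ?thesis by (auto simp: nullspace_def)
    qed
    moreover have "card ((\<lambda>i. i - 1) ` R) = card R"
    proof (intro card_image inj_onI)
      fix x y assume "x \<in> R" "y \<in> R" and eq: "x - 1 = y - 1"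
      then have "x \<ge> 1" "y \<ge> 1" using R by auto
      with eq show "x = y" by arith
    qed
    moreover have "(\<lambda>i. i - 1) ` R \<subseteq> {..<k}"
    proof (rule image_subsetI)
      fix x assume "x \<in> R"
      then have "x \<ge> 1" "x \<le> k" using R by auto
      then show "x - 1 \<in> {..<k}" by simp
    qed
    moreover have le: "card R \<le> k" using R card_mono[of "{1..k}" R] by simp
    moreover have "finite R" using R by (rule finite_subset) simp
    ultimately have "card (nullspace k c R) = 2 ^ (k - card R)"
      by (simp add: card_Pow card_Diff_subset)
    then have "cost k (nullspace k c R) = (\<Sum>i\<in>{card R..<k}. ?a i)"
      using cost_eq[of _ "k - card R" k] le by simp
    also have "\<dots> = (\<Sum>i=0..k-1. of_bool (card R \<le> i) * ?a i)"
      using k by (intro sum.mono_neutral_cong_left) auto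
    finally show ?thesis .
  qed
  have cdf: "erasure_mean p k (\<lambda>R. of_bool (card R \<le> i)) = binomial_cdf i k (1 - p)"
    if "i \<le> k" for i
  proof -
    have "erasure_mean p k (\<lambda>R. of_bool (card R \<le> i))
        = (\<Sum>R | R \<in> Pow {1..k} \<and> card R \<in> {0..i}. ?w (card R))"
      unfolding erasure_mean_def by (intro sum.mono_neutral_cong_right) auto
    also have "\<dots> = (\<Sum>j=0..i. \<Sum>R\<in>{R\<in>{R. R \<in> Pow {1..k} \<and> card R \<in> {0..i}}. card R = j}. ?w (card R))"
      by (rule sum.group[symmetric]) auto
    also have "\<dots> = (\<Sum>j=0..i. real (k choose j) * ?w j)"
    proof (rule sum.cong[OF refl])
      fix j assume j: "j \<in> {0..i}"
      have "(\<Sum>R\<in>{R\<in>{R. R \<in> Pow {1..k} \<and> card R \<in> {0..i}}. card R = j}. ?w (card R))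
          = (\<Sum>R | R \<subseteq> {1..k} \<and> card R = j. ?w j)"
        using j by (intro sum.cong) auto
      then show "(\<Sum>R\<in>{R\<in>{R. R \<in> Pow {1..k} \<and> card R \<in> {0..i}}. card R = j}. ?w (card R))
          = real (k choose j) * ?w j"
        using n_subsets[of "{1..k}" j] by simp
    qed
    finally show ?thesis by (simp add: binomial_cdf_def mult_ac)
  qed
  have "erasure_mean p k (\<lambda>R. cost k (nullspace k c R))
      = erasure_mean p k (\<lambda>R. \<Sum>i=0..k-1. ?a i * of_bool (card R \<le> i))"
    by (rule erasure_mean_cong) (simp only: cost mult.commute)
  also have "\<dots> = (\<Sum>i=0..k-1. ?a i * erasure_mean p k (\<lambda>R. of_bool (card R \<le> i)))"
    by (simp only: erasure_mean_sum erasure_mean_cmult)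
  also have "\<dots> = (\<Sum>i=0..k-1. ?a i * binomial_cdf i k (1 - p))"
    by (intro sum.cong refl arg_cong2[where f = "(*)"] cdf) auto
  finally show ?thesis .
qed

subsection \<open>Erasure patterns and the decoding time\<close>

text \<open>Since \<open>enat\<close> is countable, singletons suffice, and each is a countable
  Boolean combination of the events \<open>T x \<le> enat n\<close>.\<close>

lemma measurable_enat_iff_le:
  fixes T :: "'a \<Rightarrow> enat"
  assumes le: "\<And>n. Measurable.pred M (\<lambda>x. T x \<le> enat n)"
  shows "T \<in> measurable M (count_space UNIV)"
proof (subst measurable_count_space_eq2_countable; safe)
  fix a :: enat
  have [measurable]: "Measurable.pred M (\<lambda>x. T x \<le> enat n)" for n by (rule le)
  have "Measurable.pred M (\<lambda>x. T x = a)"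
  proof (cases a)
    case (enat n)
    have "T x = a \<longleftrightarrow> T x \<le> enat n \<and> (\<forall>m<n. \<not> T x \<le> enat m)" for x
      unfolding enat by (cases "T x") (auto simp: not_le order.order_iff_strict)
    then show ?thesis by simp
  next
    case infinity
    have "T x = a \<longleftrightarrow> (\<forall>m. \<not> T x \<le> enat m)" for x
      unfolding infinity by (cases "T x") auto
    then show ?thesis by simp
  qed
  moreover have "T -` {a} \<inter> space M = {x \<in> space M. T x = a}" by auto
  ultimately show "T -` {a} \<inter> space M \<in> sets M" by simp
qed auto

abbreviation erasure_space :: "real \<Rightarrow> (nat \<Rightarrow> bool) measure" where
  "erasure_space p \<equiv> \<Pi>\<^sub>M n\<in>UNIV. measure_pmf (bernoulli_pmf p)"

definition received :: "nat \<Rightarrow> (nat \<Rightarrow> bool) \<Rightarrow> nat set" where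
  "received n e = {i\<in>{1..n}. \<not> e i}"

lemma space_erasure_space: "space (erasure_space p) = UNIV"
  by (simp add: space_PiM)

lemma measurable_erasure [measurable]:
  "(\<lambda>e. e i) \<in> measurable (erasure_space p) (count_space UNIV)"
proof -
  have "(\<lambda>e. e i) \<in> measurable (erasure_space p) (measure_pmf (bernoulli_pmf p))"
    by (rule measurable_component_singleton) simp
  then show ?thesis by simp
qed

lemma sets_received_eq:
  "{e. received n e = R} \<in> sets (erasure_space p)"
proof -
  have "Measurable.pred (erasure_space p) (\<lambda>e. \<forall>i. (i \<in> {1..n} \<and> \<not> e i) = (i \<in> R))"
    by measurable
  then have "{e \<in> space (erasure_space p). \<forall>i. (i \<in> {1..n} \<and> \<not> e i) = (i \<in> R)} \<in> sets (erasure_space p)"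
    by (rule predE)
  moreover have "{e. received n e = R}
      = {e \<in> space (erasure_space p). \<forall>i. (i \<in> {1..n} \<and> \<not> e i) = (i \<in> R)}"
    by (auto simp: received_def space_erasure_space)
  ultimately show ?thesis by (simp only:)
qed

lemma emeasure_received_eq:
  assumes p: "0 \<le> p" "p < 1" and R: "R \<subseteq> {1..n}"
  shows "emeasure (erasure_space p) {e. received n e = R}
    = ennreal ((1 - p) ^ card R * p ^ (n - card R))"
proof -
  interpret product_prob_space "\<lambda>_. measure_pmf (bernoulli_pmf p)" UNIV
    by (rule product_prob_spaceI) (rule prob_space_measure_pmf)
  \<comment> \<open>The set \<open>{i \<notin> R}\<close> is a singleton of a truth value:
    coordinate \<open>i\<close> must be \<open>True\<close>, an erasure, exactly when
    \<open>i\<close> is outside \<open>R\<close>. This makes the event a cylinder.\<close>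
  have "{e. received n e = R}
      = {e \<in> space (erasure_space p). \<forall>i\<in>{1..n}. e i \<in> {i \<notin> R}}"
    using R by (auto simp: received_def space_erasure_space)
  then have "emeasure (erasure_space p) {e. received n e = R}
      = (\<Prod>i\<in>{1..n}. emeasure (measure_pmf (bernoulli_pmf p)) {i \<notin> R})"
    by (simp only:) (rule emeasure_PiM_Collect; simp)
  also have "\<dots> = (\<Prod>i\<in>{1..n}. ennreal (if i \<in> R then 1 - p else p))"
    using p by (intro prod.cong refl) (auto simp: emeasure_pmf_single)
  also have "\<dots> = ennreal (\<Prod>i\<in>{1..n}. if i \<in> R then 1 - p else p)"
    using p by (intro prod_ennreal) auto
  also have "(\<Prod>i\<in>{1..n}. if i \<in> R then 1 - p else p)
      = (\<Prod>i\<in>{1..n} \<inter> R. 1 - p) * (\<Prod>i\<in>{1..n} \<inter> - R. p)"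
    by (subst prod.If_cases) simp_all
  also have "{1..n} \<inter> R = R" using R by blast
  also have "{1..n} \<inter> - R = {1..n} - R" by blast
  finally show ?thesis
    using R by (simp add: card_Diff_subset finite_subset[OF R])
qed

text \<open>The bridge from the infinite product measure to the finite sums used for choosing the
  columns: the event is a finite disjoint union over the possible values of
  \<open>received n e\<close>.\<close>

lemma emeasure_received:
  assumes p: "0 \<le> p" "p < 1"
  shows "{e. P (received n e)} \<in> sets (erasure_space p)"
    and "emeasure (erasure_space p) {e. P (received n e)}
      = ennreal (erasure_mean p n (\<lambda>R. of_bool (P R)))"
proof -
  let ?I = "{R. R \<subseteq> {1..n} \<and> P R}"
  have fin: "finite ?I" by (rule finite_subset[of _ "Pow {1..n}"]) auto
  have eq: "{e. P (received n e)} = (\<Union>R\<in>?I. {e. received n e = R})"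
    by (auto simp: received_def)
  show "{e. P (received n e)} \<in> sets (erasure_space p)"
    unfolding eq using fin sets_received_eq by (intro sets.finite_UN) auto
  have "emeasure (erasure_space p) {e. P (received n e)}
      = (\<Sum>R\<in>?I. emeasure (erasure_space p) {e. received n e = R})"
    unfolding eq using fin sets_received_eq
    by (intro sum_emeasure[symmetric]) (auto simp: disjoint_family_on_def)
  also have "\<dots> = (\<Sum>R\<in>?I. ennreal ((1 - p) ^ card R * p ^ (n - card R)))"
    by (intro sum.cong refl emeasure_received_eq p) auto
  also have "\<dots> = ennreal (\<Sum>R\<in>?I. (1 - p) ^ card R * p ^ (n - card R))"
    using p by (intro sum_ennreal) auto
  also have "(\<Sum>R\<in>?I. (1 - p) ^ card R * p ^ (n - card R)) = erasure_mean p n (\<lambda>R. of_bool (P R))"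
    unfolding erasure_mean_def by (intro sum.mono_neutral_cong_left) auto
  finally show "emeasure (erasure_space p) {e. P (received n e)}
      = ennreal (erasure_mean p n (\<lambda>R. of_bool (P R)))" .
qed

text \<open>The average is the probability of an event about the received set.\<close>

lemma erasure_mean_of_bool_le_1:
  assumes p: "0 \<le> p" "p < 1"
  shows "erasure_mean p n (\<lambda>R. of_bool (P R)) \<le> 1"
proof -
  interpret prob_space "erasure_space p"
    by (intro prob_space_PiM prob_space_measure_pmf)
  have "ennreal (erasure_mean p n (\<lambda>R. of_bool (P R))) \<le> 1"
    unfolding emeasure_received(2)[OF p, symmetric] by (rule measure_le_1)
  then show ?thesis by simp
qed

section \<open>Marginals of the sample space\<close>

lemma space_sample_space: "space (sample_space p M PU) = UNIV"
  by (simp add: sample_space_def space_pair_measure space_PiM)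

lemma emeasure_sample_space_erasures:
  fixes PU :: "'u pmf"
  assumes A: "A \<in> sets (erasure_space p)"
  shows "{\<omega>. snd (snd \<omega>) \<in> A} \<in> sets (sample_space p M PU)"
    and "emeasure (sample_space p M PU) {\<omega>. snd (snd \<omega>) \<in> A} = emeasure (erasure_space p) A"
proof -
  interpret E: prob_space "erasure_space p"
    by (intro prob_space_PiM prob_space_measure_pmf)
  interpret WE: pair_prob_space "measure_pmf (pmf_of_set {1..M})" "erasure_space p" ..
  interpret UWE: pair_prob_space "measure_pmf PU"
    "measure_pmf (pmf_of_set {1..M}) \<Otimes>\<^sub>M erasure_space p" ..
  have eq: "{\<omega>. snd (snd \<omega>) \<in> A} = (UNIV :: 'u set) \<times> ((UNIV :: nat set) \<times> A)" by auto
  have WA: "(UNIV :: nat set) \<times> A \<in> sets (measure_pmf (pmf_of_set {1..M}) \<Otimes>\<^sub>M erasure_space p)"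
    using A by (intro pair_measureI) auto
  show "{\<omega>. snd (snd \<omega>) \<in> A} \<in> sets (sample_space p M PU)"
    unfolding eq sample_space_def by (rule pair_measureI[OF _ WA]) simp
  have "emeasure (sample_space p M PU) {\<omega>. snd (snd \<omega>) \<in> A}
      = emeasure (measure_pmf PU) UNIV
        * emeasure (measure_pmf (pmf_of_set {1..M}) \<Otimes>\<^sub>M erasure_space p) (UNIV \<times> A)"
    unfolding eq sample_space_def 
    by (rule sigma_finite_measure.emeasure_pair_measure_Times[OF
          prob_space_imp_sigma_finite[OF WE.prob_space_axioms] _ WA]) simp
  also have "emeasure (measure_pmf (pmf_of_set {1..M}) \<Otimes>\<^sub>M erasure_space p) (UNIV \<times> A)
      = emeasure (measure_pmf (pmf_of_set {1..M})) UNIV * emeasure (erasure_space p) A"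
    using A by (intro E.emeasure_pair_measure_Times) auto
  finally show "emeasure (sample_space p M PU) {\<omega>. snd (snd \<omega>) \<in> A} = emeasure (erasure_space p) A"
    using measure_pmf.emeasure_space_1 by simp
qed

text \<open>Messages have type \<open>nat\<close>, so their range is guaranteed only almost surely;
  correct decoding is proved on this event. Positivity of \<open>M\<close> makes
  \<open>{1..M}\<close> nonempty, so that it is the support of the uniform distribution.\<close>

lemma AE_message:
  fixes PU :: "'u pmf"
  assumes "M > 0"
  shows "AE \<omega> in sample_space p M PU. message \<omega> \<in> {1..M}"
proof -
  interpret E: prob_space "erasure_space p"
    by (intro prob_space_PiM prob_space_measure_pmf)
  interpret WE: pair_prob_space "measure_pmf (pmf_of_set {1..M})" "erasure_space p" ..
  interpret UWE: pair_prob_space "measure_pmf PU"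
    "measure_pmf (pmf_of_set {1..M}) \<Otimes>\<^sub>M erasure_space p" ..
  let ?A = "{1..M} \<times> (UNIV :: (nat \<Rightarrow> bool) set)"
  let ?WE = "measure_pmf (pmf_of_set {1..M}) \<Otimes>\<^sub>M erasure_space p"
  have A: "?A \<in> sets ?WE"
    using sets.top[of "erasure_space p"] by (intro pair_measureI) (simp_all add: space_erasure_space)
  have UA: "(UNIV :: 'u set) \<times> ?A \<in> sets (measure_pmf PU \<Otimes>\<^sub>M ?WE)"
    by (rule pair_measureI[OF _ A]) simp
  have W: "AE w in measure_pmf (pmf_of_set {1..M}). w \<in> {1..M}"
    using assms by (simp add: AE_measure_pmf_iff set_pmf_of_set)
  have WE: "AE x in ?WE. x \<in> ?A"
  proof (rule WE.AE_pair_measure)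
    show "{x \<in> space ?WE. x \<in> ?A} \<in> sets ?WE"
      using A sets.sets_into_space[OF A] by (simp only: Collect_conj_eq Collect_mem_eq Int_absorb1)
    show "AE w in measure_pmf (pmf_of_set {1..M}). AE e in erasure_space p. (w, e) \<in> ?A"
      using W by eventually_elim simp
  qed
  have "AE \<omega> in sample_space p M PU. \<omega> \<in> (UNIV :: 'u set) \<times> ?A"
    unfolding sample_space_def
  proof (rule UWE.AE_pair_measure)
    show "{\<omega> \<in> space (measure_pmf PU \<Otimes>\<^sub>M ?WE). \<omega> \<in> UNIV \<times> ?A} \<in> sets (measure_pmf PU \<Otimes>\<^sub>M ?WE)"
      using UA sets.sets_into_space[OF UA] by (simp only: Collect_conj_eq Collect_mem_eq Int_absorb1)
    show "AE u in measure_pmf PU. AE x in ?WE. (u, x) \<in> UNIV \<times> ?A"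
      using WE by simp
  qed
  then show ?thesis by eventually_elim (auto simp: message_def)
qed

text \<open>The infimum in \<open>enat\<close> is infinite when the nullspace never becomes
  trivial.\<close>

definition decoding_time :: "nat \<Rightarrow> (nat \<Rightarrow> nat set) \<Rightarrow> (nat \<Rightarrow> bool) \<Rightarrow> enat" where
  "decoding_time k c e = (INF n\<in>{n. nullspace k c (received n e) = {{}}}. enat n)"

text \<open>More received symbols can only shrink the nullspace, so once trivial it remains so and
  the infimum is governed by the state at time \<open>n\<close> alone.\<close>

lemma decoding_time_le_iff:
  "decoding_time k c e \<le> enat n \<longleftrightarrow> nullspace k c (received n e) = {{}}"
proof
  assume "nullspace k c (received n e) = {{}}"
  then show "decoding_time k c e \<le> enat n"
    unfolding decoding_time_def by (intro INF_lower) simp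
next
  assume le: "decoding_time k c e \<le> enat n"
  show "nullspace k c (received n e) = {{}}"
  proof (rule ccontr)
    assume n: "nullspace k c (received n e) \<noteq> {{}}"
    have "enat (Suc n) \<le> decoding_time k c e"
      unfolding decoding_time_def
    proof (rule INF_greatest)
      fix m assume m: "m \<in> {n. nullspace k c (received n e) = {{}}}"
      have "\<not> m \<le> n"
      proof
        assume "m \<le> n"
        then have "received m e \<subseteq> received n e" by (auto simp: received_def)
        then have "nullspace k c (received n e) \<subseteq> nullspace k c (received m e)"
          by (auto simp: nullspace_def)
        moreover have "{} \<in> nullspace k c (received n e)" by (simp add: nullspace_def)
        ultimately show False using m n by auto
      qed
      then show "enat (Suc n) \<le> enat m" by simp
    qed
    with le show False by (metis enat_ord_simps(1) not_less_eq_eq order_refl order_trans)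
  qed
qed

section \<open>Construction of the code and verification of its properties\<close>

theorem theorem3:
  fixes k :: nat and p :: real
  assumes "k \<ge> 1" and "0 \<le> p" and "p < 1"
  shows "\<exists>l :: real.
    (\<exists>(\<U> :: nat set) PU f \<tau> g. BEC_VLSF_zero_error_code p l (2 ^ k) \<U> PU f \<tau> g) \<and>
    (let C = 1 - p in
       l \<le> real k + 1 / C * (\<Sum>i=0..k-1. (2 ^ k - 1) / (2 ^ k - 2 ^ i) * binomial_cdf i k (1 - p)))"
  proof -
  let ?S = "sample_space p (2 ^ k) (return_pmf (0::nat))"
  let ?bound = "real k + 1 / (1 - p)
    * (\<Sum>i=0..k-1. (2 ^ k - 1) / (2 ^ k - 2 ^ i) * binomial_cdf i k (1 - p))"
  note p = assms(2,3)
  obtain c where c: "\<And>i. i \<in> {1..k} \<Longrightarrow> c i = {i - 1}"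
    and step: "\<And>n. n \<ge> k \<Longrightarrow> erasure_mean p (Suc n) (\<lambda>R. cost k (nullspace k c R))
      + (1 - p) * erasure_mean p n (\<lambda>R. of_bool (nullspace k c R \<noteq> {{}}))
      \<le> erasure_mean p n (\<lambda>R. cost k (nullspace k c R))"
    using exists_columns[OF assms(1), of p] by blast
  obtain enc where enc: "bij_betw enc {1..2 ^ k :: nat} (Pow {..<k})"
    using finite_same_card_bij[of "{1..2 ^ k :: nat}" "Pow {..<k}"] by (auto simp: card_Pow)
  define f where "f n (u::nat) w = odd (card (c n \<inter> enc w))" for n u w
  define \<tau> where "\<tau> \<omega> = decoding_time k c (snd (snd \<omega>))" for \<omega> :: "nat sample"
  define consistent where "consistent n u ys w \<longleftrightarrow> w \<in> {1..2 ^ k} \<and>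
      (\<forall>i\<in>{1..n}. \<forall>b. ys ! (i - 1) = Some b \<longrightarrow> b = f i u w)"
    for n u and ys :: "bool option list" and w
  \<comment> \<open>The default value 1 keeps the decoder inside the message set even for output
    lists that no message can produce.\<close>
  define g where "g n u ys = (if \<exists>w. consistent n u ys w then SOME w. consistent n u ys w else 1)"
    for n u ys
  let ?u = "\<lambda>n. erasure_mean p n (\<lambda>R. of_bool (nullspace k c R \<noteq> {{}}))"

  have nth_output: "outputs_upto f n (u, w, e) ! (i - 1) = (if e i then None else Some (f i u w))"
    if "i \<in> {1..n}" for n u w e i
    using that by (auto simp: outputs_upto_def channel_output_def simp del: upt_Suc)

  have stop: "stopping_time (output_filtration f) \<tau>"
    unfolding stopping_time_def
  proof
    fix t
    show "Measurable.pred (output_filtration f t) (\<lambda>\<omega>. \<tau> \<omega> \<le> t)"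
    proof (cases t)
      case (enat n)
      \<comment> \<open>List position \<open>i - 1\<close> holds the output of time
        \<open>i\<close>. The unerased positions recover \<open>received n e\<close>, so the
        decision to stop is a function of the outputs so far.\<close>
      let ?B = "{(u :: nat, ys). nullspace k c {i\<in>{1..n}. ys ! (i - 1) \<noteq> None} = {{}}}"
      have "(\<tau> \<omega> \<le> t) = (\<omega> \<in> (\<lambda>\<omega>. (common_rand \<omega>, outputs_upto f n \<omega>)) -` ?B)" for \<omega>
      proof -
        obtain u w e where \<omega>: "\<omega> = (u, w, e)" by (cases \<omega>) auto
        have "{i\<in>{1..n}. outputs_upto f n \<omega> ! (i - 1) \<noteq> None} = received n e"
          unfolding \<omega> received_def using nth_output by auto
        then show ?thesis by (simp add: enat \<tau>_def \<omega> decoding_time_le_iff)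
      qed
      moreover have "(\<lambda>\<omega>. (common_rand \<omega>, outputs_upto f n \<omega>)) -` ?B \<in> sets (output_filtration f t)"
        unfolding output_filtration_def by (rule in_measure_of) (simp, use enat in blast)
      ultimately show ?thesis
        unfolding pred_def by (simp add: output_filtration_def)
    qed simp
  qed

  have undecoded: "{\<omega>. \<not> \<tau> \<omega> \<le> enat n} \<in> sets ?S"
    "emeasure ?S {\<omega>. \<not> \<tau> \<omega> \<le> enat n} = ennreal (?u n)" for n
    using emeasure_sample_space_erasures[OF
        emeasure_received(1)[OF p, of "\<lambda>R. nullspace k c R \<noteq> {{}}" n], of "2 ^ k" "return_pmf 0"]
      emeasure_received(2)[OF p, of "\<lambda>R. nullspace k c R \<noteq> {{}}" n]
    by (simp_all add: \<tau>_def decoding_time_le_iff)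
  have meas: "\<tau> \<in> measurable ?S (count_space UNIV)"
  proof (rule measurable_enat_iff_le)
    fix n
    have "Measurable.pred ?S (\<lambda>\<omega>. \<not> \<tau> \<omega> \<le> enat n)"
      using undecoded(1) by (simp add: pred_def space_sample_space)
    then have "Measurable.pred ?S (\<lambda>\<omega>. \<not> \<not> \<tau> \<omega> \<le> enat n)" by measurable
    then show "Measurable.pred ?S (\<lambda>\<omega>. \<tau> \<omega> \<le> enat n)" by (simp only: not_not)
  qed

  have mean_k: "erasure_mean p k (\<lambda>R. cost k (nullspace k c R))
      = (\<Sum>i=0..k-1. (2 ^ k - 1) / (2 ^ k - 2 ^ i) * binomial_cdf i k (1 - p))"
    using assms(1) c by (rule erasure_mean_cost_systematic)
  have u_nonneg: "0 \<le> ?u n" for n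
    using p by (intro erasure_mean_nonneg) auto
  \<comment> \<open>The times below \<open>k\<close> contribute at most 1 each, which gives the
    summand \<open>k\<close>; the later times are covered by the potential argument.\<close>
  have partial: "(\<Sum>n<N. ?u n) \<le> ?bound" for N
  proof -
    have "(\<Sum>n<N. ?u n) \<le> (\<Sum>n\<in>{..<k} \<union> {k..<N}. ?u n)"
      using u_nonneg by (intro sum_mono2) auto
    also have "\<dots> = (\<Sum>n<k. ?u n) + (\<Sum>n\<in>{k..<N}. ?u n)"
      by (intro sum.union_disjoint) auto
    also have "(\<Sum>n<k. ?u n) \<le> (\<Sum>n<k. 1)"
      using erasure_mean_of_bool_le_1[OF p] by (intro sum_mono)
    also have "(\<Sum>n\<in>{k..<N}. ?u n) \<le> 1 / (1 - p) * erasure_mean p k (\<lambda>R. cost k (nullspace k c R))"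
      using p step by (rule sum_undecoded_le)
    finally show ?thesis unfolding mean_k by simp
  qed
  \<comment> \<open>The expectation is the sum of the tail probabilities, and \<open>?u n\<close> is
    the probability that \<open>\<tau>\<close> exceeds \<open>n\<close>.\<close>
  have integral: "(\<integral>\<^sup>+ \<omega>. ennreal_of_enat (\<tau> \<omega>) \<partial>?S) \<le> ennreal ?bound"
  proof -
    have "(\<integral>\<^sup>+ \<omega>. ennreal_of_enat (\<tau> \<omega>) \<partial>?S) = (\<Sum>n. ennreal (?u n))"
      unfolding nn_integral_enat_function[OF meas] undecoded(2)[symmetric]
      by (simp add: space_sample_space not_le)
    also have "\<dots> \<le> ennreal ?bound"
    proof (rule suminf_le_const)
      show "(\<Sum>n<N. ennreal (?u n)) \<le> ennreal ?bound" for N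
        using partial u_nonneg by (simp add: sum_ennreal ennreal_leI)
    qed simp
    finally show ?thesis .
  qed
  \<comment> \<open>A finite expectation rules out infinite values outside a null set.\<close>
  have finite: "AE \<omega> in ?S. \<tau> \<omega> < \<infinity>"
  proof -
    have "AE \<omega> in ?S. ennreal_of_enat (\<tau> \<omega>) \<noteq> \<infinity>"
    proof (rule nn_integral_PInf_AE)
      show "(\<lambda>\<omega>. ennreal_of_enat (\<tau> \<omega>)) \<in> borel_measurable ?S"
        using meas by (rule measurable_compose) simp
      show "(\<integral>\<^sup>+ \<omega>. ennreal_of_enat (\<tau> \<omega>) \<partial>?S) \<noteq> \<infinity>"
        using integral by (auto simp: top_unique)
    qed
    then show ?thesis
    proof eventually_elim
      case (elim \<omega>)
      then show ?case by (cases "\<tau> \<omega>") auto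
    qed
  qed

  have decode: "g n (common_rand \<omega>) (outputs_upto f n \<omega>) = message \<omega>"
    if msg: "message \<omega> \<in> {1..2 ^ k}" and n: "\<tau> \<omega> = enat n" for \<omega> n
  proof -
    obtain u w e where \<omega>: "\<omega> = (u, w, e)" by (cases \<omega>) auto
    have w: "w \<in> {1..2 ^ k}" using msg by (simp add: \<omega> message_def)
    have null: "nullspace k c (received n e) = {{}}"
      using n decoding_time_le_iff[of k c e n] by (simp add: \<tau>_def \<omega>)
    have sub: "enc v \<subseteq> {..<k}" if "v \<in> {1..2 ^ k}" for v
      using bij_betwE[OF enc] that by blast
    have fin: "finite (enc v)" if "v \<in> {1..2 ^ k}" for v
      using sub[OF that] by (rule finite_subset) simp
    have cw: "consistent n u (outputs_upto f n \<omega>) w"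
      unfolding consistent_def \<omega> using w nth_output by auto
    \<comment> \<open>The difference of two consistent messages is orthogonal to every received
      column, hence lies in the trivial nullspace.\<close>
    have unique: "v = w" if v: "consistent n u (outputs_upto f n \<omega>) v" for v
    proof -
      have v': "v \<in> {1..2 ^ k}" using v by (simp add: consistent_def)
      have "even (card (c i \<inter> sym_diff (enc v) (enc w)))" if i: "i \<in> received n e" for i
      proof -
        have i': "i \<in> {1..n}" "\<not> e i" using i by (auto simp: received_def)
        then have "f i u w = f i u v"
          using v nth_output[OF i'(1), of u w e] unfolding consistent_def \<omega> by auto
        then show ?thesis
          unfolding even_card_Int_sym_diff[OF fin[OF v'] fin[OF w]] by (simp add: f_def)
      qed
      moreover have "sym_diff (enc v) (enc w) \<subseteq> {..<k}" using sub[OF v'] sub[OF w] by blast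
      ultimately have "sym_diff (enc v) (enc w) \<in> nullspace k c (received n e)"
        unfolding nullspace_def by blast
      then have "enc v = enc w" unfolding null by blast
      then show "v = w" using enc v' w by (meson bij_betw_imp_inj_on inj_onD)
    qed
    have "(SOME v. consistent n u (outputs_upto f n \<omega>) v) = w"
      using cw unique by (rule some_equality)
    then show ?thesis using cw by (auto simp: g_def \<omega> common_rand_def message_def)
  qed
  have correct: "AE \<omega> in ?S. \<forall>n. \<tau> \<omega> = enat n \<longrightarrow>
      g n (common_rand \<omega>) (outputs_upto f n \<omega>) = message \<omega>"
    using AE_message[of "2 ^ k" p "return_pmf (0::nat)"] decode by (auto elim: eventually_mono)

  have range: "g n u ys \<in> {1..2 ^ k}" for n u ys
  proof (cases "\<exists>w. consistent n u ys w")
    case True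
    then have "consistent n u ys (g n u ys)" unfolding g_def if_P[OF True] by (rule someI_ex)
    then show ?thesis unfolding consistent_def by blast
  qed (simp add: g_def)
  \<comment> \<open>The bound itself serves as \<open>l\<close>, which has to be positive;
    \<open>k \<ge> 1\<close> provides this, the remaining term being nonnegative.\<close>
  have "0 < ?bound"
    unfolding mean_k[symmetric] using p cost_nonneg assms(1)
    by (intro add_pos_nonneg mult_nonneg_nonneg erasure_mean_nonneg) auto
  \<comment> \<open>The one-point alphabet \<open>{0}\<close> expresses that the code is
    deterministic.\<close>
  then have "BEC_VLSF_zero_error_code p ?bound (2 ^ k) {0} (return_pmf 0) f \<tau> g"
    unfolding BEC_VLSF_zero_error_code_def using stop finite integral range correct by simp
  then show ?thesis unfolding Let_def by blast
qed

end
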